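(* For every net of conics $\mathcal{L}\subset\mathbb{S}^3$ of type $G^*$, the ML-base locus $\mathbb{P}\mathcal{L}^{-1}\cap\mathbb{P}\mathcal{L}^\perp$ is a double point of rank $1$ (i.e. as a scheme it is supported at a single point, which is a matrix of rank $1$, and has degree $2$), and the ML-degree of $\mathcal{L}$ is $0$.
   Context: Everything is over $\mathbb{C}$. $\mathbb{S}^3$ is the $6$-dimensional space of complex symmetric $3\times 3$ matrices, $\mathbb{P}^5=\mathbb{P}\mathbb{S}^3$. A net of conics is a $3$-dimensional linear subspace of $\mathbb{S}^3$. For a net $\mathcal{L}$ containing an invertible matrix, $\mathbb{P}\mathcal{L}^{-1}\subset\mathbb{P}^5$ is the Zariski closure of $\mathbb{P}(\{A^{-1} \mid A\in\mathcal{L},\ \det A\neq 0\})$. The polar net is $\mathcal{L}^\perp=\{N\in\mathbb{S}^3\mid \mathrm{trace}(MN)=0 \text{ for all } M\in\mathcal{L}\}$. The ML-base locus of $\mathcal{L}$ is the (scheme-theoretic) intersection $\mathbb{P}\mathcal{L}^{-1}\cap\mathbb{P}\mathcal{L}^\perp$. The ML-degree of $\mathcal{L}$ is the number of complex critical points on $\mathcal{L}$ of $\ell_S(M)=\log\det(M)-\mathrm{trace}(SM)$ for a generic matrix $S\in\mathbb{S}^3$; that is, the number of invertible $M\in\mathcal{L}$ with $\mathrm{trace}(M^{-1}N)=\mathrm{trace}(SN)$ for all $N\in\mathcal{L}$. A symmetric matrix $M$ is identified with the quadratic form $(x,y,z)M(x,y,z)^T$; e.g. $2xy$ is the matrix with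 entries $1$ at positions $(1,2),(2,1)$ and $0$ elsewhere. Two nets are congruent if $\mathcal{L}_2=g^T\mathcal{L}_1 g$ for some $g\in \mathrm{GL}(3,\mathbb{C})$. A net is of type $G^*$ if it is congruent to the net spanned by $x^2,\ 2xy,\ 2yz$. *)

theory Defs
  imports
    "HOL-Analysis.Analysis"
    "HOL-Library.Poly_Mapping"
    "HOL-Computational_Algebra.Polynomial"
begin

section \<open>Complex symmetric matrices and nets of conics\<close>

definition mscale :: "complex \<Rightarrow> complex^3^3 \<Rightarrow> complex^3^3" where
  "mscale c A = map_matrix ((*) c) A"

global_interpretation cmat: vector_space mscale
  defines cmat_span = cmat.span
    and cmat_subspace = cmat.subspace
    and cmat_dim = cmat.dim
  by standard (simp_all add: mscale_def vec_eq_iff algebra_simps)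

definition sym3 :: "(complex^3^3) set" where
  "sym3 = {A. transpose A = A}"

definition net_of_conics :: "(complex^3^3) set \<Rightarrow> bool" where
  "net_of_conics L \<longleftrightarrow> L \<subseteq> sym3 \<and> cmat_subspace L \<and> cmat_dim L = 3"

definition congruent_nets :: "(complex^3^3) set \<Rightarrow> (complex^3^3) set \<Rightarrow> bool" where
  "congruent_nets L1 L2 \<longleftrightarrow>
     (\<exists>g :: complex^3^3. invertible g \<and> L2 = (\<lambda>A. transpose g ** A ** g) ` L1)"

definition conic_x2 :: "complex^3^3" where
  "conic_x2 = vector [vector [1, 0, 0], vector [0, 0, 0], vector [0, 0, 0]]"

definition conic_2xy :: "complex^3^3" where
  "conic_2xy = vector [vector [0, 1, 0], vector [1, 0, 0], vector [0, 0, 0]]"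

definition conic_2yz :: "complex^3^3" where
  "conic_2yz = vector [vector [0, 0, 0], vector [0, 0, 1], vector [0, 1, 0]]"

lemma conic_quadratic_forms:
  fixes v :: "complex^3"
  shows "(\<Sum>i\<in>UNIV. \<Sum>j\<in>UNIV. v $ i * conic_x2 $ i $ j * v $ j) = (v $ 1)\<^sup>2"
    and "(\<Sum>i\<in>UNIV. \<Sum>j\<in>UNIV. v $ i * conic_2xy $ i $ j * v $ j) = 2 * v $ 1 * v $ 2"
    and "(\<Sum>i\<in>UNIV. \<Sum>j\<in>UNIV. v $ i * conic_2yz $ i $ j * v $ j) = 2 * v $ 2 * v $ 3"
  by (simp_all add: sum_3 conic_x2_def conic_2xy_def conic_2yz_def power2_eq_square)

definition type_Gstar :: "(complex^3^3) set \<Rightarrow> bool" where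
  "type_Gstar L \<longleftrightarrow> congruent_nets (cmat_span {conic_x2, conic_2xy, conic_2yz}) L"

definition inverse_net :: "(complex^3^3) set \<Rightarrow> (complex^3^3) set" where
  "inverse_net L = {matrix_inv A | A. A \<in> L \<and> det A \<noteq> 0}"

definition polar_net :: "(complex^3^3) set \<Rightarrow> (complex^3^3) set" where
  "polar_net L = {N \<in> sym3. \<forall>M\<in>L. trace (M ** N) = 0}"


section \<open>The polynomial ring in the six coordinates of a symmetric matrix\<close>

datatype sym_var = X11 | X12 | X13 | X22 | X23 | X33

fun coord :: "complex^3^3 \<Rightarrow> sym_var \<Rightarrow> complex" where
  "coord A X11 = A $ 1 $ 1"
| "coord A X12 = A $ 1 $ 2"
| "coord A X13 = A $ 1 $ 3"
| "coord A X22 = A $ 2 $ 2"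
| "coord A X23 = A $ 2 $ 3"
| "coord A X33 = A $ 3 $ 3"

text \<open>A polynomial is a finitely supported map from exponent vectors to coefficients;
  \<^theory>\<open>HOL-Library.Poly_Mapping\<close> provides the ring structure (multiplication is convolution).\<close>

type_synonym sym_poly = "(sym_var \<Rightarrow>\<^sub>0 nat) \<Rightarrow>\<^sub>0 complex"

definition poly_eval :: "sym_poly \<Rightarrow> complex^3^3 \<Rightarrow> complex" where
  "poly_eval f A =
     (\<Sum>m\<in>Poly_Mapping.keys f. Poly_Mapping.lookup f m * (\<Prod>v\<in>Poly_Mapping.keys m. coord A v ^ Poly_Mapping.lookup m v))"

definition homogeneous_part :: "nat \<Rightarrow> sym_poly set" where
  "homogeneous_part d = {f. \<forall>m\<in>Poly_Mapping.keys f. (\<Sum>v\<in>Poly_Mapping.keys m. Poly_Mapping.lookup m v) = d}"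

definition poly_scale :: "complex \<Rightarrow> sym_poly \<Rightarrow> sym_poly" where
  "poly_scale c f = Poly_Mapping.single 0 c * f"

global_interpretation sympoly: vector_space poly_scale
  defines sympoly_dim = sympoly.dim
  by standard
    (simp_all add: poly_scale_def algebra_simps single_add mult_single
      flip: mult.assoc)


section \<open>Projective closed sets and closed subschemes\<close>

text \<open>A point of projective space is the set of all its (nonzero) representatives.\<close>

definition proj_point :: "complex^3^3 \<Rightarrow> (complex^3^3) set" where
  "proj_point A = {mscale c A | c. c \<noteq> 0}"

definition proj :: "(complex^3^3) set \<Rightarrow> (complex^3^3) set set" where
  "proj V = proj_point ` (V - {0})"

definition proj_zeros :: "sym_poly set \<Rightarrow> (complex^3^3) set set" where
  "proj_zeros F = {P \<in> proj sym3. \<forall>f\<in>F. \<forall>A\<in>P. poly_eval f A = 0}"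

definition proj_closed :: "(complex^3^3) set set \<Rightarrow> bool" where
  "proj_closed Z \<longleftrightarrow> (\<exists>F. F \<subseteq> (\<Union>d. homogeneous_part d) \<and> Z = proj_zeros F)"

definition vanishing_ideal :: "(complex^3^3) set set \<Rightarrow> sym_poly set" where
  "vanishing_ideal X = {f. \<forall>P\<in>X. \<forall>A\<in>P. poly_eval f A = 0}"

definition reciprocal_variety :: "(complex^3^3) set \<Rightarrow> (complex^3^3) set set" where
  "reciprocal_variety L = proj_closed hull proj (inverse_net L)"

text \<open>Closed subschemes of projective space are given by homogeneous ideals \<open>I\<close> of the
  coordinate ring \<open>R\<close>, as \<open>Proj (R / I)\<close>.  The scheme-theoretic intersection
  corresponds to the sum of ideals; closed sets carry the reduced structure.\<close>

definition ideal_sum :: "sym_poly set \<Rightarrow> sym_poly set \<Rightarrow> sym_poly set" where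
  "ideal_sum I J = {f + g | f g. f \<in> I \<and> g \<in> J}"

definition base_locus_ideal :: "(complex^3^3) set \<Rightarrow> sym_poly set" where
  "base_locus_ideal L =
     ideal_sum (vanishing_ideal (reciprocal_variety L)) (vanishing_ideal (proj (polar_net L)))"

text \<open>The dimension of the degree \<open>d\<close> part of \<open>R / I\<close>, for a homogeneous ideal \<open>I\<close>
  (the subtraction does not truncate).\<close>

definition hilbert_function :: "sym_poly set \<Rightarrow> nat \<Rightarrow> nat" where
  "hilbert_function I d =
     sympoly_dim (homogeneous_part d) - sympoly_dim (I \<inter> homogeneous_part d)"

definition hilbert_polynomial :: "sym_poly set \<Rightarrow> real poly" where
  "hilbert_polynomial I =
     (THE p. \<forall>\<^sub>F d in sequentially. poly p (real d) = real (hilbert_function I d))"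

definition scheme_degree :: "sym_poly set \<Rightarrow> real" where
  "scheme_degree I =
     (let p = hilbert_polynomial I in fact (Polynomial.degree p) * lead_coeff p)"

definition double_point_at :: "sym_poly set \<Rightarrow> (complex^3^3) set \<Rightarrow> bool" where
  "double_point_at I P \<longleftrightarrow> proj_zeros I = {P} \<and> scheme_degree I = 2"


section \<open>The maximum likelihood degree\<close>

text \<open>Critical points on \<open>L\<close> of \<open>log det M - trace (S M)\<close>: the derivative at \<open>M\<close> in direction
  \<open>N\<close> is \<open>trace (M\<^sup>-\<^sup>1 N) - trace (S N)\<close>.\<close>

definition critical_points :: "(complex^3^3) set \<Rightarrow> complex^3^3 \<Rightarrow> (complex^3^3) set" where
  "critical_points L S =
     {M \<in> L. invertible M \<and> (\<forall>N\<in>L. trace (matrix_inv M ** N) = trace (S ** N))}"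

definition generic_sym :: "(complex^3^3 \<Rightarrow> bool) \<Rightarrow> bool" where
  "generic_sym Q \<longleftrightarrow> (\<exists>f :: sym_poly. f \<noteq> 0 \<and> (\<forall>S\<in>sym3. poly_eval f S \<noteq> 0 \<longrightarrow> Q S))"

text \<open>Finiteness is required explicitly because the cardinality of an infinite set is \<open>0\<close>.\<close>

definition ml_degree :: "(complex^3^3) set \<Rightarrow> nat" where
  "ml_degree L =
     (THE n. generic_sym (\<lambda>S. finite (critical_points L S) \<and> card (critical_points L S) = n))"

end

theory Submission
  imports Defs "HOL-Number_Theory.Cong"
begin

text \<open>Write \<open>L = g\<^sup>T L\<^sub>0 g\<close> with \<open>L\<^sub>0\<close> the standard net, and let \<open>Y\<^sub>v\<close> be the linear forms reading off the
  entries of \<open>g A g\<^sup>T\<close>.  The adjugates of \<open>L\<^sub>0\<close> trace out the quadric cone \<open>X12 = X22 = 0\<close>,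
  \<open>X13\<^sup>2 = X11 X33\<close>, and the polar net of \<open>L\<^sub>0\<close> is \<open>X11 = X12 = X23 = 0\<close>, so the ideal \<open>I\<close> of the base
  locus of \<open>L\<close> contains \<open>Y11, Y12, Y22, Y23, Y13\<^sup>2\<close>.  Hence each graded piece of \<open>R / I\<close> in positive
  degree \<open>d\<close> is spanned by \<open>Y33\<^sup>d\<close> and \<open>Y13 Y33\<^sup>d\<^sup>-\<^sup>1\<close>.  These are independent modulo \<open>I\<close>: a curve on
  the reciprocal cone and a line in the polar net agree modulo \<open>s\<^sup>2\<close>, so \<open>s\<^sup>2\<close> divides the restriction
  of every element of \<open>I\<close> to the curve, while \<open>\<alpha> Y33\<^sup>d + \<beta> Y13 Y33\<^sup>d\<^sup>-\<^sup>1\<close> restricts to \<open>\<alpha> + \<beta> s\<close>.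
  For the ML-degree, a critical point for \<open>S\<close> forces \<open>Y12(S) = 0\<close>, which fails generically.\<close>

section \<open>Evaluation of polynomials\<close>

lemma UNIV_sym_var: "UNIV = {X11, X12, X13, X22, X23, X33}"
  using sym_var.exhaust by auto

instance sym_var :: finite
  by standard (simp add: UNIV_sym_var)

lemma sum_sym_var: "(\<Sum>v\<in>UNIV. f v) = f X11 + f X12 + f X13 + f X22 + f X23 + f X33"
  for f :: "sym_var \<Rightarrow> 'a::comm_monoid_add"
  by (simp add: UNIV_sym_var add.assoc)

lemma prod_sym_var: "(\<Prod>v\<in>UNIV. f v) = f X11 * f X12 * f X13 * f X22 * f X23 * f X33"
  for f :: "sym_var \<Rightarrow> 'a::comm_monoid_mult"
  by (simp add: UNIV_sym_var mult.assoc)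

lemma prod_keys_eq_prod_UNIV:
  fixes x :: "'v::finite \<Rightarrow> 'a::comm_semiring_1"
  shows "(\<Prod>v\<in>Poly_Mapping.keys m. x v ^ Poly_Mapping.lookup m v) = (\<Prod>v\<in>UNIV. x v ^ Poly_Mapping.lookup m v)"
  by (rule prod.mono_neutral_left) (auto simp: in_keys_iff)

text \<open>The ring is left arbitrary because monomials are evaluated at numbers, at one-variable
  polynomials (curves) and at linear forms.\<close>

definition monomial_at :: "(sym_var \<Rightarrow> 'a::comm_semiring_1) \<Rightarrow> (sym_var \<Rightarrow>\<^sub>0 nat) \<Rightarrow> 'a" where
  "monomial_at x m = (\<Prod>v\<in>UNIV. x v ^ Poly_Mapping.lookup m v)"

lemma monomial_at_add: "monomial_at x (m + n) = monomial_at x m * monomial_at x n"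
  by (simp add: monomial_at_def lookup_add power_add prod.distrib)

lemma monomial_at_0 [simp]: "monomial_at x 0 = 1"
  by (simp add: monomial_at_def)

lemma poly_eval_eq_sum_monomial_at:
  "poly_eval f A =
    (\<Sum>m\<in>Poly_Mapping.keys f. Poly_Mapping.lookup f m * monomial_at (coord A) m)"
  unfolding poly_eval_def monomial_at_def by (simp add: prod_keys_eq_prod_UNIV)

lemma poly_eval_add [simp]: "poly_eval (f + g) A = poly_eval f A + poly_eval g A"
  unfolding poly_eval_eq_sum_monomial_at
  by (rule setsum_keys_plus_distrib) (simp_all add: algebra_simps)

lemma poly_eval_0 [simp]: "poly_eval 0 A = 0"
  by (simp add: poly_eval_def)

lemma poly_eval_sum [simp]: "poly_eval (\<Sum>i\<in>S. f i) A = (\<Sum>i\<in>S. poly_eval (f i) A)"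
  by (induction S rule: infinite_finite_induct) simp_all

lemma poly_eval_uminus [simp]: "poly_eval (- f) A = - poly_eval f A"
  using poly_eval_add[of f "- f" A] by (simp add: eq_neg_iff_add_eq_0 add.commute)

lemma poly_eval_diff [simp]: "poly_eval (f - g) A = poly_eval f A - poly_eval g A"
  using poly_eval_add[of f "- g" A] by simp

lemma poly_eval_single:
  "poly_eval (Poly_Mapping.single m c) A = c * monomial_at (coord A) m"
  by (simp add: poly_eval_eq_sum_monomial_at)

lemma sum_single_lookup: "(\<Sum>m\<in>Poly_Mapping.keys f. Poly_Mapping.single m (Poly_Mapping.lookup f m)) = f"
  by (rule poly_mapping_eqI) (auto simp: lookup_sum lookup_single when_def in_keys_iff)

lemma poly_eval_mult [simp]: "poly_eval (f * g) A = poly_eval f A * poly_eval g A"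
proof -
  have "f * g = (\<Sum>m\<in>Poly_Mapping.keys f. \<Sum>n\<in>Poly_Mapping.keys g.
      Poly_Mapping.single (m + n) (Poly_Mapping.lookup f m * Poly_Mapping.lookup g n))"
    by (subst (1) sum_single_lookup[of f, symmetric], subst (1) sum_single_lookup[of g, symmetric])
      (simp only: sum_product mult_single)
  then show ?thesis
    by (simp add: poly_eval_single monomial_at_add poly_eval_eq_sum_monomial_at[of f]
        poly_eval_eq_sum_monomial_at[of g] sum_product mult.commute mult.left_commute)
qed

lemma poly_eval_1 [simp]: "poly_eval 1 A = 1"
  using poly_eval_single[of 0 1 A] by simp

lemma poly_eval_power [simp]: "poly_eval (f ^ n) A = poly_eval f A ^ n"
  by (induction n) simp_all

lemma poly_eval_prod [simp]: "poly_eval (\<Prod>i\<in>S. f i) A = (\<Prod>i\<in>S. poly_eval (f i) A)"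
  by (induction S rule: infinite_finite_induct) simp_all

lemma poly_eval_const [simp]: "poly_eval (Poly_Mapping.single 0 c) A = c"
  by (simp add: poly_eval_single)

lemma poly_eval_scale [simp]: "poly_eval (poly_scale c f) A = c * poly_eval f A"
  by (simp add: poly_scale_def)

section \<open>Restriction of polynomials to parametrized curves\<close>

definition curve_poly :: "(sym_var \<Rightarrow> complex poly) \<Rightarrow> sym_poly \<Rightarrow> complex poly" where
  "curve_poly x f =
    (\<Sum>m\<in>Poly_Mapping.keys f. smult (Poly_Mapping.lookup f m) (monomial_at x m))"

lemma poly_curve_poly:
  assumes "\<And>v. poly (x v) s = coord A v"
  shows "poly (curve_poly x f) s = poly_eval f A"
  by (simp add: curve_poly_def poly_eval_eq_sum_monomial_at monomial_at_def poly_sum poly_prod assms)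

text \<open>Sums and products respect congruences. This will compare the restrictions to two curves
  that agree to first order.\<close>

lemma cong_curve_poly:
  assumes "\<And>v. [x v = y v] (mod p)"
  shows "[curve_poly x f = curve_poly y f] (mod p)"
proof -
  \<comment> \<open>The coefficient is written as a constant polynomial so that the product rule for
    congruences covers scaling.\<close>
  have "[[:c:] * monomial_at x m = [:c:] * monomial_at y m] (mod p)" for c m
    unfolding monomial_at_def by (intro cong_mult cong_prod cong_pow cong_refl assms)
  then show ?thesis
    unfolding curve_poly_def by (intro cong_sum) simp
qed

definition sym_of :: "(sym_var \<Rightarrow> complex) \<Rightarrow> complex^3^3" where
  "sym_of x = vector [vector [x X11, x X12, x X13], vector [x X12, x X22, x X23],
     vector [x X13, x X23, x X33]]"

lemma coord_sym_of [simp]: "coord (sym_of x) v = x v"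
  by (cases v) (simp_all add: sym_of_def)

lemma sym3_iff: "A \<in> sym3 \<longleftrightarrow> A $ 2 $ 1 = A $ 1 $ 2 \<and> A $ 3 $ 1 = A $ 1 $ 3 \<and> A $ 3 $ 2 = A $ 2 $ 3"
  by (auto simp: sym3_def transpose_def vec_eq_iff forall_3)

lemma sym_of_in_sym3 [simp]: "sym_of x \<in> sym3"
  by (simp add: sym3_iff sym_of_def)

section \<open>Kronecker substitution and the existence of points off hypersurfaces\<close>

text \<open>The weights are the powers \<open>N^0, ..., N^5\<close>: if all exponents are below
  \<open>N\<close>, the weighted total degree is a base \<open>N\<close> numeral whose digits are
  the exponents.\<close>

fun kronecker_weight :: "nat \<Rightarrow> sym_var \<Rightarrow> nat" where
  "kronecker_weight N X11 = 1"
| "kronecker_weight N X12 = N"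
| "kronecker_weight N X13 = N * N"
| "kronecker_weight N X22 = N * N * N"
| "kronecker_weight N X23 = N * N * N * N"
| "kronecker_weight N X33 = N * N * N * N * N"

lemma base_expansion_step:
  fixes a b c d N :: nat
  assumes "a + N * b = c + N * d" "a < N" "c < N"
  shows "a = c \<and> b = d"
proof -
  have "(a + N * b) mod N = a" "(c + N * d) mod N = c"
    using assms(2,3) by simp_all
  then have "a = c"
    using assms(1) by metis
  with assms show ?thesis by simp
qed

lemma kronecker_weight_inj:
  assumes "(\<Sum>v\<in>UNIV. kronecker_weight N v * a v) = (\<Sum>v\<in>UNIV. kronecker_weight N v * b v)"
    and a: "\<And>v. a v < N" and b: "\<And>v. b v < N"
  shows "a = b"
proof -
  have "a X11 + N * (a X12 + N * (a X13 + N * (a X22 + N * (a X23 + N * a X33)))) =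
      b X11 + N * (b X12 + N * (b X13 + N * (b X22 + N * (b X23 + N * b X33))))"
    using assms(1) by (simp add: sum_sym_var algebra_simps)
  note e1 = base_expansion_step[OF this a b]
  note e2 = base_expansion_step[OF e1[THEN conjunct2] a b]
  note e3 = base_expansion_step[OF e2[THEN conjunct2] a b]
  note e4 = base_expansion_step[OF e3[THEN conjunct2] a b]
  note e5 = base_expansion_step[OF e4[THEN conjunct2] a b]
  have "a v = b v" for v
    using e1 e2 e3 e4 e5 by (cases v) auto
  then show ?thesis by auto
qed

lemma monomial_at_monom:
  "monomial_at (\<lambda>v. monom (1::complex) (w v)) m = monom 1 (\<Sum>v\<in>UNIV. w v * Poly_Mapping.lookup m v)"
  by (simp add: monomial_at_def prod_sym_var sum_sym_var monom_power mult_monom add.assoc)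

text \<open>Kronecker substitution turns distinct monomials into distinct powers of a single variable.\<close>

lemma kronecker_curve_poly_nonzero:
  assumes "f \<noteq> 0" and bound: "\<And>m v. m \<in> Poly_Mapping.keys f \<Longrightarrow> Poly_Mapping.lookup m v < N"
  shows "curve_poly (\<lambda>v. monom 1 (kronecker_weight N v)) f \<noteq> 0"
proof -
  define e where "e m = (\<Sum>v\<in>UNIV. kronecker_weight N v * Poly_Mapping.lookup m v)" for m
  obtain m where m: "m \<in> Poly_Mapping.keys f"
    using assms(1) by (auto simp: poly_mapping_eq_iff fun_eq_iff in_keys_iff)
  have inj: "e m' = e m \<longleftrightarrow> m' = m" if "m' \<in> Poly_Mapping.keys f" for m'
  proof
    assume "e m' = e m"
    then have "Poly_Mapping.lookup m' = Poly_Mapping.lookup m"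
      unfolding e_def by (rule kronecker_weight_inj) (intro bound that m)+
    then show "m' = m"
      by (simp only: poly_mapping_eq_iff)
  qed simp
  have "coeff (curve_poly (\<lambda>v. monom 1 (kronecker_weight N v)) f) (e m) =
      (\<Sum>m'\<in>Poly_Mapping.keys f. if m' = m then Poly_Mapping.lookup f m' else 0)"
    unfolding curve_poly_def monomial_at_monom coeff_sum e_def[symmetric]
    by (intro sum.cong) (auto simp: inj)
  also have "\<dots> = Poly_Mapping.lookup f m"
    using m by simp
  finally show ?thesis
    using m by (auto simp: in_keys_iff)
qed

lemma exponents_bounded:
  fixes f :: sym_poly
  obtains N where "\<And>m v. m \<in> Poly_Mapping.keys f \<Longrightarrow> Poly_Mapping.lookup m v < N"
proof
  fix m v assume m: "m \<in> Poly_Mapping.keys f"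
  have "finite ((\<lambda>(m, v). Poly_Mapping.lookup m v) ` (Poly_Mapping.keys f \<times> UNIV))"
    by simp
  moreover have "Poly_Mapping.lookup m v \<in> (\<lambda>(m, v). Poly_Mapping.lookup m v) ` (Poly_Mapping.keys f \<times> UNIV)"
    using m by force
  ultimately show "Poly_Mapping.lookup m v <
      Suc (Max ((\<lambda>(m, v). Poly_Mapping.lookup m v) ` (Poly_Mapping.keys f \<times> UNIV)))"
    using Max_ge less_Suc_eq_le by blast
qed

text \<open>Both polynomials stay nonzero on a common Kronecker curve, and a nonzero product in one
  variable has a non-root. Thus two generic conditions can be met by one symmetric matrix.\<close>

lemma ex_common_nonzero:
  fixes f g :: sym_poly
  assumes "f \<noteq> 0" "g \<noteq> 0"
  obtains A where "A \<in> sym3" "poly_eval f A \<noteq> 0" "poly_eval g A \<noteq> 0"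
proof -
  obtain N1 where N1: "\<And>m v. m \<in> Poly_Mapping.keys f \<Longrightarrow> Poly_Mapping.lookup m v < N1"
    using exponents_bounded[of f] by blast
  obtain N2 where N2: "\<And>m v. m \<in> Poly_Mapping.keys g \<Longrightarrow> Poly_Mapping.lookup m v < N2"
    using exponents_bounded[of g] by blast
  \<comment> \<open>The larger base exceeds every exponent of \<open>f\<close> and of
    \<open>g\<close>, so one curve serves both.\<close>
  define x :: "sym_var \<Rightarrow> complex poly" where
    "x v = monom 1 (kronecker_weight (max N1 N2) v)" for v
  have "curve_poly x f * curve_poly x g \<noteq> 0"
    unfolding x_def using assms N1 N2
    by (intro no_zero_divisors kronecker_curve_poly_nonzero) (auto simp: less_max_iff_disj)
  then obtain s where s: "poly (curve_poly x f * curve_poly x g) s \<noteq> 0"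
    using poly_all_0_iff_0 by blast
  have "poly (curve_poly x h) s = poly_eval h (sym_of (\<lambda>v. poly (x v) s))" for h
    by (rule poly_curve_poly) simp
  with s show thesis
    by (intro that[of "sym_of (\<lambda>v. poly (x v) s)"]) auto
qed

text \<open>A nonzero difference would be nonzero at some symmetric matrix. Polynomial identities
  may therefore be checked on values.\<close>

lemma sym_poly_eqI:
  assumes "\<And>A. A \<in> sym3 \<Longrightarrow> poly_eval f A = poly_eval g A"
  shows "f = g"
proof (rule ccontr)
  assume "f \<noteq> g"
  then have "f - g \<noteq> 0" by simp
  then obtain A where "A \<in> sym3" "poly_eval (f - g) A \<noteq> 0"
    using ex_common_nonzero by blast
  with assms show False by simp
qed

section \<open>Graded pieces and Hilbert functions\<close>

lemma homogeneous_part_0 [simp]: "0 \<in> homogeneous_part d"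
  by (simp add: homogeneous_part_def)

lemma homogeneous_part_iff:
  "f \<in> homogeneous_part d \<longleftrightarrow>
    (\<forall>m\<in>Poly_Mapping.keys f. (\<Sum>v\<in>UNIV. Poly_Mapping.lookup m v) = d)"
proof -
  have "(\<Sum>v\<in>Poly_Mapping.keys m. Poly_Mapping.lookup m v) = (\<Sum>v\<in>UNIV. Poly_Mapping.lookup m v)"
    for m :: "sym_var \<Rightarrow>\<^sub>0 nat"
    by (rule sum.mono_neutral_left) (auto simp: in_keys_iff)
  then show ?thesis
    by (simp add: homogeneous_part_def)
qed

lemma homogeneous_part_add:
  "f \<in> homogeneous_part d \<Longrightarrow> g \<in> homogeneous_part d \<Longrightarrow> f + g \<in> homogeneous_part d"
  using keys_add[of f g] by (auto simp: homogeneous_part_iff)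

lemma homogeneous_part_mult:
  assumes "f \<in> homogeneous_part d" "g \<in> homogeneous_part e"
  shows "f * g \<in> homogeneous_part (d + e)"
  unfolding homogeneous_part_iff
proof
  fix m assume "m \<in> Poly_Mapping.keys (f * g)"
  then obtain a b where "m = a + b" "a \<in> Poly_Mapping.keys f" "b \<in> Poly_Mapping.keys g"
    using keys_mult[of f g] by blast
  with assms show "(\<Sum>v\<in>UNIV. Poly_Mapping.lookup m v) = d + e"
    by (simp add: homogeneous_part_iff lookup_add sum.distrib)
qed

lemma homogeneous_part_const: "Poly_Mapping.single 0 c \<in> homogeneous_part 0"
  by (simp add: homogeneous_part_iff)

lemma homogeneous_part_scale: "f \<in> homogeneous_part d \<Longrightarrow> poly_scale c f \<in> homogeneous_part d"
  using homogeneous_part_mult[OF homogeneous_part_const] by (simp add: poly_scale_def)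

lemma homogeneous_part_sum:
  "(\<And>i. i \<in> S \<Longrightarrow> f i \<in> homogeneous_part d) \<Longrightarrow> (\<Sum>i\<in>S. f i) \<in> homogeneous_part d"
  by (induction S rule: infinite_finite_induct) (auto intro: homogeneous_part_add)

lemma homogeneous_part_1: "1 \<in> homogeneous_part 0"
  using homogeneous_part_const[of 1] by simp

lemma homogeneous_part_power: "f \<in> homogeneous_part d \<Longrightarrow> f ^ n \<in> homogeneous_part (n * d)"
  by (induction n) (auto intro: homogeneous_part_mult homogeneous_part_1)

lemma homogeneous_part_prod:
  "(\<And>i. i \<in> S \<Longrightarrow> f i \<in> homogeneous_part (d i)) \<Longrightarrow> (\<Prod>i\<in>S. f i) \<in> homogeneous_part (\<Sum>i\<in>S. d i)"
  by (induction S rule: infinite_finite_induct) (auto intro: homogeneous_part_mult homogeneous_part_1)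

lemma homogeneous_part_diff:
  assumes "f \<in> homogeneous_part d" "g \<in> homogeneous_part d" shows "f - g \<in> homogeneous_part d"
proof -
  have "f - g = f + poly_scale (- 1) g"
    by (simp add: poly_scale_def single_uminus)
  also have "\<dots> \<in> homogeneous_part d"
    by (intro homogeneous_part_add homogeneous_part_scale assms)
  finally show ?thesis .
qed

lemma subspace_homogeneous_part: "sympoly.subspace (homogeneous_part d)"
  by (intro sympoly.subspaceI homogeneous_part_0 homogeneous_part_add homogeneous_part_scale)

text \<open>Only finitely many exponent vectors have total degree \<open>d\<close>, since each
  exponent is at most \<open>d\<close>.\<close>

lemma homogeneous_part_finite_span:
  obtains T where "finite T" "homogeneous_part d \<subseteq> sympoly.span T"
proof
  define M where "M = {m :: sym_var \<Rightarrow>\<^sub>0 nat. (\<Sum>v\<in>UNIV. Poly_Mapping.lookup m v) = d}"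
  have "Poly_Mapping.lookup m v \<le> d" if "m \<in> M" for m v
    using member_le_sum[of v UNIV "Poly_Mapping.lookup m"] that by (simp add: M_def)
  then have "Poly_Mapping.lookup ` M \<subseteq> UNIV \<rightarrow>\<^sub>E {..d}"
    by (auto simp: PiE_iff)
  moreover have "finite ((UNIV :: sym_var set) \<rightarrow>\<^sub>E {..d})"
    by (rule finite_PiE) simp_all
  ultimately have "finite (Poly_Mapping.lookup ` M)"
    by (rule finite_subset)
  moreover have "inj_on Poly_Mapping.lookup M"
    by (simp add: inj_on_def)
  ultimately have "finite M"
    by (rule finite_imageD)
  then show "finite ((\<lambda>m. Poly_Mapping.single m (1::complex)) ` M)" by simp
  show "homogeneous_part d \<subseteq> sympoly.span ((\<lambda>m. Poly_Mapping.single m 1) ` M)"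
  proof
    fix f assume f: "f \<in> homogeneous_part d"
    have "f = (\<Sum>m\<in>Poly_Mapping.keys f. poly_scale (Poly_Mapping.lookup f m) (Poly_Mapping.single m 1))"
      by (simp add: poly_scale_def mult_single sum_single_lookup)
    also have "\<dots> \<in> sympoly.span ((\<lambda>m. Poly_Mapping.single m 1) ` M)"
      using f by (intro sympoly.span_sum sympoly.span_scale sympoly.span_base)
        (auto simp: homogeneous_part_iff M_def)
    finally show "f \<in> sympoly.span ((\<lambda>m. Poly_Mapping.single m 1) ` M)" .
  qed
qed

text \<open>A basis of the degree \<open>d\<close> part of \<open>I\<close>, extended by
  \<open>u\<close> and \<open>v\<close>, becomes a basis of all forms of degree
  \<open>d\<close>.\<close>

lemma hilbert_function_eq_2I:
  assumes I: "sympoly.subspace I"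
    and u: "u \<in> homogeneous_part d" and v: "v \<in> homogeneous_part d"
    and spanning: "homogeneous_part d \<subseteq> sympoly.span (insert u (insert v I))"
    and independent: "\<And>\<alpha> \<beta>. poly_scale \<alpha> u + poly_scale \<beta> v \<in> I \<Longrightarrow> \<alpha> = 0 \<and> \<beta> = 0"
  shows "hilbert_function I d = 2"
proof -
  define K where "K = I \<inter> homogeneous_part d"
  have K: "sympoly.subspace K"
    unfolding K_def by (intro sympoly.subspace_inter I subspace_homogeneous_part)
  obtain B where B: "B \<subseteq> K" "sympoly.independent B" "K \<subseteq> sympoly.span B" "card B = sympoly.dim K"
    by (rule sympoly.basis_exists)
  have spanB: "sympoly.span B = K"
    using B K by (metis sympoly.span_subspace)
  obtain T where T: "finite T" "homogeneous_part d \<subseteq> sympoly.span T"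
    by (rule homogeneous_part_finite_span)
  \<comment> \<open>Dimensions are cardinalities of bases, and \<open>card\<close> is 0 on infinite
    sets, so finiteness is essential for the count.\<close>
  have finB: "finite B"
    using sympoly.independent_span_bound[OF T(1) B(2)] B(1) T(2) by (auto simp: K_def)
  have vK: "v \<notin> sympoly.span B"
    using independent[of 0 1] by (auto simp: spanB K_def)
  have uK: "u \<notin> sympoly.span (insert v B)"
  proof
    assume "u \<in> sympoly.span (insert v B)"
    then obtain k where "u - poly_scale k v \<in> I"
      unfolding sympoly.span_insert spanB by (auto simp: K_def)
    with independent[of 1 "- k"] show False
      by simp
  qed
  have ind: "sympoly.independent (insert u (insert v B))"
    by (intro sympoly.independent_insertI uK vK B(2))
  have "homogeneous_part d \<subseteq> sympoly.span (insert u (insert v B))"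
  proof
    fix f assume f: "f \<in> homogeneous_part d"
    then have "f \<in> sympoly.span (insert u (insert v I))"
      using spanning by blast
    then obtain \<alpha> \<beta> where "f - poly_scale \<alpha> u - poly_scale \<beta> v \<in> sympoly.span I"
      unfolding sympoly.span_insert by blast
    then have "f - (poly_scale \<alpha> u + poly_scale \<beta> v) \<in> I"
      using I by (simp add: diff_diff_eq sympoly.span_eq_iff[THEN iffD2])
    \<comment> \<open>Spanning only puts the remainder into \<open>I\<close>; homogeneity of
      \<open>f\<close>, \<open>u\<close> and \<open>v\<close> puts it into \<open>K\<close>.\<close>
    moreover have "f - (poly_scale \<alpha> u + poly_scale \<beta> v) \<in> homogeneous_part d"
      by (intro homogeneous_part_diff homogeneous_part_add homogeneous_part_scale f u v)
    ultimately have "f - (poly_scale \<alpha> u + poly_scale \<beta> v) \<in> K"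
      by (simp add: K_def)
    then have "f - poly_scale \<alpha> u \<in> sympoly.span (insert v B)"
      unfolding sympoly.span_insert[of v] spanB diff_diff_eq[symmetric] by blast
    then show "f \<in> sympoly.span (insert u (insert v B))"
      unfolding sympoly.span_insert[of u] by blast
  qed
  moreover have "insert u (insert v B) \<subseteq> homogeneous_part d"
    using u v B(1) by (auto simp: K_def)
  ultimately have "sympoly.dim (homogeneous_part d) = card (insert u (insert v B))"
    using ind by (metis sympoly.basis_card_eq_dim)
  also have "\<dots> = card B + 2"
  proof -
    have "v \<notin> B" "u \<notin> insert v B"
      using uK vK sympoly.span_base by blast+
    with finB show ?thesis by simp
  qed
  also have "\<dots> = sympoly.dim K + 2"
    by (simp add: B(4))
  finally show ?thesis
    by (simp add: hilbert_function_def K_def sympoly_dim_def)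
qed

text \<open>Two polynomials that agree at all large integers differ by one with infinitely many
  roots, so the definite description is unique.\<close>

lemma hilbert_polynomial_eqI:
  assumes "\<forall>\<^sub>F d in sequentially. poly p (real d) = real (hilbert_function I d)"
  shows "hilbert_polynomial I = p"
  unfolding hilbert_polynomial_def
proof (rule the_equality)
  fix q assume "\<forall>\<^sub>F d in sequentially. poly q (real d) = real (hilbert_function I d)"
  with assms have "\<forall>\<^sub>F d in sequentially. poly (q - p) (real d) = 0"
    by eventually_elim simp
  then obtain n where n: "\<And>d. d \<ge> n \<Longrightarrow> poly (q - p) (real d) = 0"
    by (auto simp: eventually_sequentially)
  have "infinite (real ` {n..})"
    by (simp add: finite_image_iff infinite_Ici)
  moreover have "real ` {n..} \<subseteq> {x. poly (q - p) x = 0}"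
    using n by auto
  ultimately have "q - p = 0"
    by (metis finite_subset poly_roots_finite)
  then show "q = p" by simp
qed (rule assms)

section \<open>Congruence action on symmetric matrices\<close>

lemma matrix_inv_eqI:
  fixes A B :: "'a::field^'n^'n"
  assumes "A ** B = mat 1"
  shows "matrix_inv A = B"
  unfolding matrix_inv_def
proof (rule some_equality)
  show "A ** B = mat 1 \<and> B ** A = mat 1"
    using assms by (simp add: matrix_left_right_inverse)
next
  fix C assume "A ** C = mat 1 \<and> C ** A = mat 1"
  then have "B = C ** A ** B" by simp
  also have "\<dots> = C"
    by (simp add: assms flip: matrix_mul_assoc)
  finally show "C = B" ..
qed

lemma coord_add [simp]: "coord (A + B) v = coord A v + coord B v"
  by (cases v) simp_all

lemma coord_mscale [simp]: "coord (mscale c A) v = c * coord A v"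
  by (cases v) (simp_all add: mscale_def)

lemma coord_0 [simp]: "coord 0 v = 0"
  by (cases v) simp_all

lemma sym3_eqI:
  assumes "A \<in> sym3" "B \<in> sym3" "\<And>v. coord A v = coord B v"
  shows "A = B"
  using assms(1,2) assms(3)[of X11] assms(3)[of X12] assms(3)[of X13] assms(3)[of X22]
    assms(3)[of X23] assms(3)[of X33]
  by (simp add: vec_eq_iff forall_3 sym3_iff)

text \<open>With the transpose on the right this is a left action. Nets move by
  \<open>act (transpose g)\<close>; their inverses and polars then move by \<open>act h\<close> for
  the inverse \<open>h\<close> of \<open>g\<close>.\<close>

definition act :: "complex^3^3 \<Rightarrow> complex^3^3 \<Rightarrow> complex^3^3" where
  "act g A = g ** A ** transpose g"

lemma act_in_sym3 [simp]: "A \<in> sym3 \<Longrightarrow> act g A \<in> sym3"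
  by (simp add: sym3_def act_def matrix_transpose_mul matrix_mul_assoc)

lemma act_add: "act g (A + B) = act g A + act g B"
  by (simp add: act_def vec_eq_iff matrix_matrix_mult_def distrib_left distrib_right sum.distrib)

lemma mscale_mult_left: "mscale c A ** B = mscale c (A ** B)"
  by (simp add: vec_eq_iff mscale_def matrix_matrix_mult_def sum_distrib_left mult.assoc)

lemma mscale_mult_right: "A ** mscale c B = mscale c (A ** B)"
  by (simp add: vec_eq_iff mscale_def matrix_matrix_mult_def sum_distrib_left mult.left_commute)

lemma act_mscale: "act g (mscale c A) = mscale c (act g A)"
  by (simp add: act_def mscale_mult_left mscale_mult_right)

lemma act_act: "act g (act h A) = act (g ** h) A"
  by (simp add: act_def matrix_transpose_mul matrix_mul_assoc)

lemma act_mat_1 [simp]: "act (mat 1) A = A"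
  by (simp add: act_def)

lemma act_0 [simp]: "act g 0 = 0"
  by (simp add: act_def)

lemma mscale_in_sym3 [simp]: "A \<in> sym3 \<Longrightarrow> mscale c A \<in> sym3"
  by (simp add: sym3_iff mscale_def)

lemma add_in_sym3 [simp]: "A \<in> sym3 \<Longrightarrow> B \<in> sym3 \<Longrightarrow> A + B \<in> sym3"
  by (simp add: sym3_iff)

text \<open>Cyclicity of the trace makes \<open>act (transpose g)\<close> and \<open>act g\<close>
  adjoint.\<close>

lemma trace_act: "trace (act (transpose g) A ** B) = trace (A ** act g B)"
proof -
  have "trace (act (transpose g) A ** B) = trace (transpose g ** (A ** g ** B))"
    by (simp add: act_def matrix_mul_assoc)
  also have "\<dots> = trace (A ** act g B)"
    by (subst trace_mul_sym) (simp add: act_def matrix_mul_assoc)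
  finally show ?thesis .
qed

section \<open>Linear forms and linear changes of coordinates\<close>

definition sym_unit :: "sym_var \<Rightarrow> complex^3^3" where
  "sym_unit w = sym_of (\<lambda>v. if v = w then 1 else 0)"

lemma sym_unit_in_sym3 [simp]: "sym_unit w \<in> sym3"
  by (simp add: sym_unit_def)

lemma coord_sym_unit [simp]: "coord (sym_unit w) v = (if v = w then 1 else 0)"
  by (simp add: sym_unit_def)

text \<open>The coefficient at \<open>w\<close> is the value of the form on
  \<open>sym_unit w\<close>, so by linearity the form reads off coordinate \<open>v\<close> of
  \<open>act g A\<close>.\<close>

definition linear_form :: "complex^3^3 \<Rightarrow> sym_var \<Rightarrow> sym_poly" where
  "linear_form g v =
    (\<Sum>w\<in>UNIV. Poly_Mapping.single (Poly_Mapping.single w 1) (coord (act g (sym_unit w)) v))"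

lemma monomial_at_single: "monomial_at x (Poly_Mapping.single w 1) = x w"
  by (simp add: monomial_at_def lookup_single when_def if_distrib[of "\<lambda>n. x _ ^ n"] cong: if_cong)

lemma sum_mscale_sym_unit:
  assumes "A \<in> sym3"
  shows "A = mscale (coord A X11) (sym_unit X11) + mscale (coord A X12) (sym_unit X12)
    + mscale (coord A X13) (sym_unit X13) + mscale (coord A X22) (sym_unit X22)
    + mscale (coord A X23) (sym_unit X23) + mscale (coord A X33) (sym_unit X33)"
proof (rule sym3_eqI)
  show "coord A v = coord (mscale (coord A X11) (sym_unit X11) + mscale (coord A X12) (sym_unit X12)
    + mscale (coord A X13) (sym_unit X13) + mscale (coord A X22) (sym_unit X22)
    + mscale (coord A X23) (sym_unit X23) + mscale (coord A X33) (sym_unit X33)) v" for v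
    by (cases v) (simp_all del: coord.simps)
qed (use assms in simp_all)

lemma poly_eval_linear_form [simp]:
  assumes "A \<in> sym3"
  shows "poly_eval (linear_form g v) A = coord (act g A) v"
proof -
  have "poly_eval (linear_form g v) A = (\<Sum>w\<in>UNIV. coord (act g (sym_unit w)) v * coord A w)"
    by (simp add: linear_form_def poly_eval_single monomial_at_single del: One_nat_def)
  also have "\<dots> = coord (act g A) v"
    by (subst (2) sum_mscale_sym_unit[OF assms])
      (simp add: act_add act_mscale sum_sym_var mult.commute del: coord.simps)
  finally show ?thesis .
qed

lemma homogeneous_linear_form: "linear_form g v \<in> homogeneous_part 1"
  unfolding linear_form_def
  by (intro homogeneous_part_sum) (simp add: homogeneous_part_def)

lemma homogeneous_monomial_at_linear_form:
  "monomial_at (linear_form g) m \<in> homogeneous_part (\<Sum>v\<in>UNIV. Poly_Mapping.lookup m v)"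
proof -
  have "linear_form g v ^ n \<in> homogeneous_part n" for v n
    using homogeneous_part_power[OF homogeneous_linear_form, of g v n] by simp
  then show ?thesis
    unfolding monomial_at_def by (intro homogeneous_part_prod)
qed

text \<open>The pullback of \<open>f\<close> along \<open>act g\<close>, obtained by substituting
  the linear forms for the variables.\<close>

definition linear_change :: "complex^3^3 \<Rightarrow> sym_poly \<Rightarrow> sym_poly" where
  "linear_change g f =
    (\<Sum>m\<in>Poly_Mapping.keys f. poly_scale (Poly_Mapping.lookup f m) (monomial_at (linear_form g) m))"

lemma poly_eval_linear_change:
  assumes "A \<in> sym3"
  shows "poly_eval (linear_change g f) A = poly_eval f (act g A)"
  using assms
  by (simp add: linear_change_def monomial_at_def poly_eval_eq_sum_monomial_at[of f])

lemma homogeneous_linear_change: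
  "f \<in> homogeneous_part d \<Longrightarrow> linear_change g f \<in> homogeneous_part d"
  unfolding linear_change_def
  by (intro homogeneous_part_sum homogeneous_part_scale)
    (metis homogeneous_part_iff homogeneous_monomial_at_linear_form)

text \<open>On values the two pullbacks compose to evaluation at \<open>act h (act g A)\<close>,
  which is \<open>A\<close>. Hence every polynomial is a polynomial in the forms
  \<open>linear_form g v\<close>.\<close>

lemma linear_change_inverse:
  assumes "h ** g = mat 1"
  shows "linear_change g (linear_change h f) = f"
  by (rule sym_poly_eqI) (simp add: poly_eval_linear_change act_act assms)

section \<open>The ideal of the base locus\<close>

lemma self_in_proj_point [simp]: "A \<in> proj_point A"
  by (auto simp: proj_point_def intro!: exI[of _ 1])

lemma vanishing_ideal_add:
  "f \<in> vanishing_ideal X \<Longrightarrow> g \<in> vanishing_ideal X \<Longrightarrow> f + g \<in> vanishing_ideal X"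
  by (simp add: vanishing_ideal_def)

lemma vanishing_ideal_mult: "f \<in> vanishing_ideal X \<Longrightarrow> f * g \<in> vanishing_ideal X"
  by (simp add: vanishing_ideal_def)

lemma zero_in_vanishing_ideal [simp]: "0 \<in> vanishing_ideal X"
  by (simp add: vanishing_ideal_def)

lemma vanishing_ideal_proj_iff:
  "f \<in> vanishing_ideal (proj V) \<longleftrightarrow>
    (\<forall>A\<in>V. \<forall>c. A \<noteq> 0 \<longrightarrow> c \<noteq> 0 \<longrightarrow> poly_eval f (mscale c A) = 0)"
  by (auto simp: vanishing_ideal_def proj_def proj_point_def)

text \<open>The zero set of a homogeneous \<open>f\<close> is closed, so if it contains the inverses
  it contains their closure.\<close>

lemma vanishing_ideal_reciprocalI:
  assumes "f \<in> homogeneous_part d" "inverse_net L \<subseteq> sym3" "f \<in> vanishing_ideal (proj (inverse_net L))"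
  shows "f \<in> vanishing_ideal (reciprocal_variety L)"
proof -
  have "reciprocal_variety L \<subseteq> proj_zeros {f}"
    unfolding reciprocal_variety_def
  proof (rule hull_minimal)
    show "proj (inverse_net L) \<subseteq> proj_zeros {f}"
      using assms(2,3) by (auto simp: proj_zeros_def vanishing_ideal_def proj_def)
    show "proj_closed (proj_zeros {f})"
      unfolding proj_closed_def using assms(1) by (intro exI[of _ "{f}"]) auto
  qed
  then show ?thesis
    by (auto simp: vanishing_ideal_def proj_zeros_def)
qed

lemma vanishing_ideal_reciprocalD:
  assumes "f \<in> vanishing_ideal (reciprocal_variety L)"
  shows "f \<in> vanishing_ideal (proj (inverse_net L))"
  using assms hull_subset[of "proj (inverse_net L)" proj_closed]
  by (auto simp: vanishing_ideal_def reciprocal_variety_def)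

lemma base_locus_idealI:
  assumes "f \<in> vanishing_ideal (reciprocal_variety L) \<or> f \<in> vanishing_ideal (proj (polar_net L))"
  shows "f \<in> base_locus_ideal L"
  using assms by (force simp: base_locus_ideal_def ideal_sum_def)

lemma base_locus_idealE:
  assumes "f \<in> base_locus_ideal L"
  obtains f1 f2 where "f = f1 + f2" "f1 \<in> vanishing_ideal (proj (inverse_net L))"
    "f2 \<in> vanishing_ideal (proj (polar_net L))"
  using assms vanishing_ideal_reciprocalD by (auto simp: base_locus_ideal_def ideal_sum_def)

lemma base_locus_ideal_add:
  assumes "f \<in> base_locus_ideal L" "g \<in> base_locus_ideal L"
  shows "f + g \<in> base_locus_ideal L"
proof -
  from assms obtain f1 f2 g1 g2 where
    "f = f1 + f2" "g = g1 + g2" and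
    f1: "f1 \<in> vanishing_ideal (reciprocal_variety L)" "g1 \<in> vanishing_ideal (reciprocal_variety L)" and
    f2: "f2 \<in> vanishing_ideal (proj (polar_net L))" "g2 \<in> vanishing_ideal (proj (polar_net L))"
    by (auto simp: base_locus_ideal_def ideal_sum_def)
  then have "f + g = (f1 + g1) + (f2 + g2)" by simp
  then show ?thesis
    unfolding base_locus_ideal_def ideal_sum_def
    using vanishing_ideal_add[OF f1] vanishing_ideal_add[OF f2] by blast
qed

lemma base_locus_ideal_mult:
  assumes "f \<in> base_locus_ideal L"
  shows "f * g \<in> base_locus_ideal L"
proof -
  from assms obtain f1 f2 where "f = f1 + f2" and
    f1: "f1 \<in> vanishing_ideal (reciprocal_variety L)" and
    f2: "f2 \<in> vanishing_ideal (proj (polar_net L))"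
    by (auto simp: base_locus_ideal_def ideal_sum_def)
  then have "f * g = f1 * g + f2 * g" by (simp add: distrib_right)
  then show ?thesis
    unfolding base_locus_ideal_def ideal_sum_def
    using vanishing_ideal_mult[OF f1] vanishing_ideal_mult[OF f2] by blast
qed

lemma base_locus_ideal_dvd: "f \<in> base_locus_ideal L \<Longrightarrow> f dvd g \<Longrightarrow> g \<in> base_locus_ideal L"
  by (auto simp: dvd_def intro: base_locus_ideal_mult)

lemma subspace_base_locus_ideal: "sympoly.subspace (base_locus_ideal L)"
proof (rule sympoly.subspaceI)
  show "0 \<in> base_locus_ideal L"
    by (intro base_locus_idealI) simp
  show "poly_scale c f \<in> base_locus_ideal L" if "f \<in> base_locus_ideal L" for c f
    using base_locus_ideal_mult[OF that, of "Poly_Mapping.single 0 c"]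
    by (simp add: poly_scale_def mult.commute[of f])
qed (rule base_locus_ideal_add)

section \<open>Nets of type \<open>G\<^sup>*\<close>\<close>

definition std_conic :: "complex \<Rightarrow> complex \<Rightarrow> complex \<Rightarrow> complex^3^3" where
  "std_conic a b c = vector [vector [a, b, 0], vector [b, 0, c], vector [0, c, 0]]"

lemma std_net_eq: "cmat_span {conic_x2, conic_2xy, conic_2yz} = {std_conic a b c | a b c. True}"
proof (intro subset_antisym subsetI)
  have "cmat.subspace {std_conic a b c | a b c. True}"
  proof (rule cmat.subspaceI)
    have "0 = std_conic 0 0 0"
      by (simp add: std_conic_def vec_eq_iff forall_3)
    then show "0 \<in> {std_conic a b c | a b c. True}" by blast
    have add: "std_conic a b c + std_conic a' b' c' = std_conic (a + a') (b + b') (c + c')" for a b c a' b' c'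
      by (simp add: std_conic_def vec_eq_iff forall_3)
    have scale: "mscale k (std_conic a b c) = std_conic (k * a) (k * b) (k * c)" for k a b c
      by (simp add: std_conic_def mscale_def vec_eq_iff forall_3)
    fix A B k assume "A \<in> {std_conic a b c | a b c. True}"
    then obtain a b c where A: "A = std_conic a b c" by blast
    then show "mscale k A \<in> {std_conic a b c | a b c. True}"
      using scale by blast
    assume "B \<in> {std_conic a b c | a b c. True}"
    with A show "A + B \<in> {std_conic a b c | a b c. True}"
      using add by blast
  qed
  moreover have "conic_x2 = std_conic 1 0 0" "conic_2xy = std_conic 0 1 0" "conic_2yz = std_conic 0 0 1"
    by (simp_all add: std_conic_def conic_x2_def conic_2xy_def conic_2yz_def)
  then have "{conic_x2, conic_2xy, conic_2yz} \<subseteq> {std_conic a b c | a b c. True}"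
    by blast
  ultimately show "A \<in> {std_conic a b c | a b c. True}"
    if "A \<in> cmat_span {conic_x2, conic_2xy, conic_2yz}" for A
    using that cmat.span_minimal unfolding cmat_span_def by blast
next
  fix A assume "A \<in> {std_conic a b c | a b c. True}"
  then obtain a b c where "A = std_conic a b c" by blast
  then have "A = mscale a conic_x2 + mscale b conic_2xy + mscale c conic_2yz"
    by (simp add: std_conic_def conic_x2_def conic_2xy_def conic_2yz_def mscale_def vec_eq_iff forall_3)
  also have "\<dots> \<in> cmat.span {conic_x2, conic_2xy, conic_2yz}"
    by (intro cmat.span_add cmat.span_scale cmat.span_base) simp_all
  finally show "A \<in> cmat_span {conic_x2, conic_2xy, conic_2yz}"
    by (simp add: cmat_span_def)
qed

text \<open>The adjugate of \<open>std_conic a b c\<close> divided by its determinant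
  \<open>- a * c^2\<close>.\<close>

definition std_inverse :: "complex \<Rightarrow> complex \<Rightarrow> complex \<Rightarrow> complex^3^3" where
  "std_inverse a b c = vector [vector [1 / a, 0, - b / (a * c)], vector [0, 0, 1 / c],
     vector [- b / (a * c), 1 / c, b\<^sup>2 / (a * c\<^sup>2)]]"

lemma std_conic_mult_std_inverse:
  assumes "a \<noteq> 0" "c \<noteq> 0"
  shows "std_conic a b c ** std_inverse a b c = mat 1"
  using assms by (simp add: std_conic_def std_inverse_def vec_eq_iff forall_3 matrix_matrix_mult_def
      sum_3 mat_def power2_eq_square)

lemma det_std_conic: "det (std_conic a b c) = - a * c\<^sup>2"
  by (simp add: det_3 std_conic_def power2_eq_square)

lemma std_inverse_in_sym3 [simp]: "std_inverse a b c \<in> sym3"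
  by (simp add: sym3_iff std_inverse_def)

lemma std_conic_in_sym3 [simp]: "std_conic a b c \<in> sym3"
  by (simp add: sym3_iff std_conic_def)

lemma trace_std_conic:
  assumes "B \<in> sym3"
  shows "trace (std_conic a b c ** B) =
    a * coord B X11 + 2 * b * coord B X12 + 2 * c * coord B X23"
  using assms by (simp add: sym3_iff trace_def std_conic_def matrix_matrix_mult_def sum_3 algebra_simps)

text \<open>The matrix \<open>g\<close> moves the net into standard position: \<open>act g\<close>
  takes inverses and polar matrices of \<open>L\<close> to those of the standard net, and
  \<open>act h\<close> takes them back.\<close>

locale Gstar_net =
  fixes g h :: "complex^3^3" and L :: "(complex^3^3) set"
  assumes gh: "g ** h = mat 1" and hg: "h ** g = mat 1"
    and L_eq: "L = {act (transpose g) (std_conic a b c) | a b c. True}"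
begin

lemma act_gh [simp]: "act g (act h A) = A" and act_hg [simp]: "act h (act g A) = A"
  by (simp_all add: act_act gh hg)

lemma polar_net_iff:
  "N \<in> polar_net L \<longleftrightarrow> N \<in> sym3 \<and>
    coord (act g N) X11 = 0 \<and> coord (act g N) X12 = 0 \<and> coord (act g N) X23 = 0"
proof (cases "N \<in> sym3")
  case True
  define p q r where "p = coord (act g N) X11" and "q = coord (act g N) X12"
    and "r = coord (act g N) X23"
  have tr: "trace (act (transpose g) (std_conic a b c) ** N) = a * p + 2 * b * q + 2 * c * r" for a b c
    unfolding trace_act p_def q_def r_def by (rule trace_std_conic) (simp add: True)
  have "(\<forall>M\<in>L. trace (M ** N) = 0) \<longleftrightarrow> (\<forall>a b c. a * p + 2 * b * q + 2 * c * r = 0)"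
    unfolding L_eq tr[symmetric] by blast
  also have "\<dots> \<longleftrightarrow> p = 0 \<and> q = 0 \<and> r = 0"
  proof
    \<comment> \<open>Testing on the three generators of the net isolates \<open>p\<close>,
      \<open>q\<close> and \<open>r\<close>.\<close>
    assume *: "\<forall>a b c. a * p + 2 * b * q + 2 * c * r = 0"
    from *[rule_format, of 1 0 0] *[rule_format, of 0 1 0] *[rule_format, of 0 0 1]
    show "p = 0 \<and> q = 0 \<and> r = 0" by simp
  qed simp
  finally show ?thesis
    using True by (simp add: polar_net_def p_def q_def r_def del: coord.simps)
qed (simp add: polar_net_def)

lemma matrix_inv_net:
  assumes "a \<noteq> 0" "c \<noteq> 0"
  shows "matrix_inv (act (transpose g) (std_conic a b c)) = act h (std_inverse a b c)"
proof (rule matrix_inv_eqI)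
  have "act (transpose g) (std_conic a b c) ** act h (std_inverse a b c) =
      transpose g ** (std_conic a b c ** ((g ** h) ** std_inverse a b c)) ** transpose h"
    by (simp add: act_def matrix_mul_assoc)
  also have "\<dots> = transpose (h ** g)"
    by (simp add: gh std_conic_mult_std_inverse assms matrix_transpose_mul)
  finally show "act (transpose g) (std_conic a b c) ** act h (std_inverse a b c) = mat 1"
    by (simp add: hg)
qed

lemma det_net: "det (act (transpose g) (std_conic a b c)) \<noteq> 0 \<longleftrightarrow> a \<noteq> 0 \<and> c \<noteq> 0"
proof -
  have "det g * det h = 1"
    using gh by (metis det_I det_mul)
  then have "det g \<noteq> 0" by auto
  then show ?thesis
    by (auto simp: act_def det_mul det_std_conic)
qed

lemma inverse_net_iff:
  "A \<in> inverse_net L \<longleftrightarrow> (\<exists>a b c. a \<noteq> 0 \<and> c \<noteq> 0 \<and> A = act h (std_inverse a b c))"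
proof
  assume "A \<in> inverse_net L"
  then obtain a b c where "det (act (transpose g) (std_conic a b c)) \<noteq> 0"
    and A: "A = matrix_inv (act (transpose g) (std_conic a b c))"
    unfolding inverse_net_def L_eq by blast
  then have "a \<noteq> 0 \<and> c \<noteq> 0"
    using det_net by blast
  with A show "\<exists>a b c. a \<noteq> 0 \<and> c \<noteq> 0 \<and> A = act h (std_inverse a b c)"
    using matrix_inv_net by blast
next
  assume "\<exists>a b c. a \<noteq> 0 \<and> c \<noteq> 0 \<and> A = act h (std_inverse a b c)"
  then obtain a b c where "a \<noteq> 0" "c \<noteq> 0" and A: "A = act h (std_inverse a b c)"
    by blast
  then have "A = matrix_inv (act (transpose g) (std_conic a b c))"
    "det (act (transpose g) (std_conic a b c)) \<noteq> 0"
    using matrix_inv_net det_net by simp_all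
  then show "A \<in> inverse_net L"
    unfolding inverse_net_def L_eq by blast
qed

lemma inverse_net_subset_sym3: "inverse_net L \<subseteq> sym3"
  by (auto simp: inverse_net_iff)

text \<open>Since \<open>act g\<close> cancels \<open>act h\<close>, the equations can be read off
  the entries of \<open>std_inverse\<close>.\<close>

lemma coord_act_inverse_net:
  assumes "A \<in> inverse_net L"
  shows "coord (act g A) X12 = 0" "coord (act g A) X22 = 0"
    "(coord (act g A) X13)\<^sup>2 = coord (act g A) X11 * coord (act g A) X33"
  using assms by (auto simp: inverse_net_iff std_inverse_def power2_eq_square)

section \<open>Elements of the ideal of the base locus\<close>

abbreviation Y :: "sym_var \<Rightarrow> sym_poly" where
  "Y \<equiv> linear_form g"

text \<open>Three of the forms cut out the polar net; the remaining one, \<open>Y X22\<close>, comes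
  from the reciprocal variety.\<close>

lemma Y_in_base_locus_ideal:
  assumes "v \<in> {X11, X12, X22, X23}"
  shows "Y v \<in> base_locus_ideal L"
proof -
  have "Y v \<in> vanishing_ideal (proj (polar_net L))" if "v \<in> {X11, X12, X23}"
    using that by (auto simp: vanishing_ideal_proj_iff polar_net_iff act_mscale simp del: coord.simps)
  moreover have "Y X22 \<in> vanishing_ideal (reciprocal_variety L)"
  proof (rule vanishing_ideal_reciprocalI)
    show "Y X22 \<in> vanishing_ideal (proj (inverse_net L))"
      using coord_act_inverse_net(2) inverse_net_subset_sym3
      by (auto simp: vanishing_ideal_proj_iff act_mscale subset_iff simp del: coord.simps)
  qed (rule homogeneous_linear_form inverse_net_subset_sym3)+
  ultimately show ?thesis
    using assms base_locus_idealI by blast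
qed

text \<open>The equation of the quadric cone lies in the ideal, and its mixed term is a multiple of
  \<open>Y X11\<close>, which does too.\<close>

lemma Y13_square_in_base_locus_ideal: "(Y X13)\<^sup>2 \<in> base_locus_ideal L"
proof -
  have "(Y X13)\<^sup>2 - Y X11 * Y X33 \<in> vanishing_ideal (reciprocal_variety L)"
  proof (rule vanishing_ideal_reciprocalI)
    show "(Y X13)\<^sup>2 - Y X11 * Y X33 \<in> vanishing_ideal (proj (inverse_net L))"
      using coord_act_inverse_net(3) inverse_net_subset_sym3
      by (auto simp: vanishing_ideal_proj_iff act_mscale subset_iff power_mult_distrib power2_eq_square
          simp del: coord.simps)
    show "(Y X13)\<^sup>2 - Y X11 * Y X33 \<in> homogeneous_part (1 + 1)"
      unfolding power2_eq_square
      by (intro homogeneous_part_diff homogeneous_part_mult homogeneous_linear_form)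
  qed (rule inverse_net_subset_sym3)
  then have "(Y X13)\<^sup>2 - Y X11 * Y X33 \<in> base_locus_ideal L"
    by (intro base_locus_idealI) simp
  moreover have "Y X11 * Y X33 \<in> base_locus_ideal L"
    by (intro base_locus_ideal_mult Y_in_base_locus_ideal) simp
  ultimately show ?thesis
    using base_locus_ideal_add by fastforce
qed

text \<open>A conic on the cone over the reciprocal surface through the rank one point; to first order
  in \<open>s\<close> it agrees with a line in the polar net.\<close>

definition cone_curve :: "complex \<Rightarrow> complex^3^3" where
  "cone_curve s = act h (sym_unit X33 + mscale s (sym_unit X13)
     + mscale (s\<^sup>2) (sym_unit X11 + sym_unit X23))"

definition polar_line :: "complex \<Rightarrow> complex^3^3" where
  "polar_line s = act h (sym_unit X33 + mscale s (sym_unit X13))"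

lemma cone_curve_in_inverse_net:
  assumes "s \<noteq> 0"
  shows "cone_curve s \<in> inverse_net L"
proof -
  \<comment> \<open>These solve \<open>1/a = 1/c = s^2\<close> and \<open>-b/(a*c) = s\<close> with
    \<open>c = a\<close>; the last entry \<open>b^2/(a*c^2)\<close> is then 1.\<close>
  define a b where "a = 1 / s\<^sup>2" and "b = - 1 / s ^ 3"
  have "sym_unit X33 + mscale s (sym_unit X13) + mscale (s\<^sup>2) (sym_unit X11 + sym_unit X23)
      = std_inverse a b a"
    using assms by (simp add: a_def b_def vec_eq_iff forall_3 std_inverse_def sym_unit_def sym_of_def mscale_def
        field_simps power2_eq_square power3_eq_cube)
  then show ?thesis
    unfolding inverse_net_iff cone_curve_def using assms
    by (intro exI[of _ a] exI[of _ b]) (simp add: a_def)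
qed

lemma polar_line_in_polar_net: "polar_line s \<in> polar_net L"
  by (simp add: polar_net_iff polar_line_def del: coord.simps)

lemma act_g_nonzeroI: "coord (act g A) v \<noteq> 0 \<Longrightarrow> A \<noteq> 0"
  by auto

lemma cone_curve_nonzero: "cone_curve s \<noteq> 0" and polar_line_nonzero: "polar_line s \<noteq> 0"
  by (rule act_g_nonzeroI[of _ X33], simp add: cone_curve_def polar_line_def del: coord.simps)+

section \<open>Restriction of the ideal to the curve on the cone\<close>

text \<open>The factor \<open>c\<close> is there because a projective point consists of all its
  nonzero multiples, and vanishing is required on each of them.\<close>

definition cone_curve_coord :: "complex \<Rightarrow> sym_var \<Rightarrow> complex poly" where
  "cone_curve_coord c v = [:c * coord (act h (sym_unit X33)) v, c * coord (act h (sym_unit X13)) v,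
     c * coord (act h (sym_unit X11 + sym_unit X23)) v:]"

definition polar_line_coord :: "complex \<Rightarrow> sym_var \<Rightarrow> complex poly" where
  "polar_line_coord c v = [:c * coord (act h (sym_unit X33)) v, c * coord (act h (sym_unit X13)) v:]"

lemma poly_cone_curve_coord:
  "poly (cone_curve_coord c v) s = coord (mscale c (cone_curve s)) v"
  by (simp add: cone_curve_coord_def cone_curve_def act_add act_mscale algebra_simps power2_eq_square
      del: coord.simps)

lemma poly_polar_line_coord:
  "poly (polar_line_coord c v) s = coord (mscale c (polar_line s)) v"
  by (simp add: polar_line_coord_def polar_line_def act_add act_mscale algebra_simps del: coord.simps)

lemma curve_poly_cone_curve_eq_0:
  assumes f: "f \<in> vanishing_ideal (proj (inverse_net L))" and "c \<noteq> 0"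
  shows "curve_poly (cone_curve_coord c) f = 0"
proof -
  \<comment> \<open>At \<open>s = 0\<close> the curve leaves the set of inverses; the extra factor
    \<open>s\<close> makes the product vanish there as well.\<close>
  have "poly ([:0, 1:] * curve_poly (cone_curve_coord c) f) s = 0" for s
    using f \<open>c \<noteq> 0\<close> cone_curve_in_inverse_net[of s] cone_curve_nonzero[of s]
    by (cases "s = 0") (auto simp: vanishing_ideal_proj_iff poly_curve_poly[OF poly_cone_curve_coord])
  then have "[:0, 1:] * curve_poly (cone_curve_coord c) f = 0"
    using poly_all_0_iff_0 by blast
  then show ?thesis by simp
qed

lemma curve_poly_polar_line_eq_0:
  assumes f: "f \<in> vanishing_ideal (proj (polar_net L))" and "c \<noteq> 0"
  shows "curve_poly (polar_line_coord c) f = 0"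
proof -
  have "poly (curve_poly (polar_line_coord c) f) s = 0" for s
    using f \<open>c \<noteq> 0\<close> polar_line_in_polar_net[of s] polar_line_nonzero[of s]
    by (auto simp: vanishing_ideal_proj_iff poly_curve_poly[OF poly_polar_line_coord])
  then show ?thesis
    using poly_all_0_iff_0 by blast
qed

text \<open>The reciprocal summand of \<open>f\<close> restricts to 0 on the curve. The polar
  summand restricts to 0 on the line, which is congruent to the curve modulo
  \<open>s^2\<close>.\<close>

lemma dvd_curve_poly_base_locus_ideal:
  assumes f: "f \<in> base_locus_ideal L" and "c \<noteq> 0"
  shows "[:0, 0, 1:] dvd curve_poly (cone_curve_coord c) f"
proof -
  obtain f1 f2 where f_eq: "f = f1 + f2" and
    f1: "f1 \<in> vanishing_ideal (proj (inverse_net L))" and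
    f2: "f2 \<in> vanishing_ideal (proj (polar_net L))"
    using f by (rule base_locus_idealE)
  have "curve_poly (cone_curve_coord c) f =
      curve_poly (cone_curve_coord c) f1 + curve_poly (cone_curve_coord c) f2"
    by (intro poly_eqI_degree_lead_coeff poly_ext)
      (simp add: poly_curve_poly[OF poly_cone_curve_coord] f_eq)
  also have "\<dots> = curve_poly (cone_curve_coord c) f2"
    by (simp add: curve_poly_cone_curve_eq_0 f1 assms)
  finally have *: "curve_poly (cone_curve_coord c) f = curve_poly (cone_curve_coord c) f2" .
  have "[cone_curve_coord c v = polar_line_coord c v] (mod [:0, 0, 1:])" for v
  proof -
    have "cone_curve_coord c v - polar_line_coord c v =
        [:0, 0, 1:] * [:c * coord (act h (sym_unit X11 + sym_unit X23)) v:]"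
      by (simp add: cone_curve_coord_def polar_line_coord_def)
    then show ?thesis
      unfolding cong_iff_dvd_diff by (metis dvd_triv_left)
  qed
  then have "[curve_poly (cone_curve_coord c) f2 = curve_poly (polar_line_coord c) f2] (mod [:0, 0, 1:])"
    by (rule cong_curve_poly)
  then show ?thesis
    by (simp add: * curve_poly_polar_line_eq_0 f2 assms cong_0_iff)
qed

section \<open>Support and Hilbert function of the base locus\<close>

lemma rank_one_point_in_sym3 [simp]: "act h (sym_unit X33) \<in> sym3"
  by simp

text \<open>The matrix is the outer product of the third column of \<open>h\<close> with itself, and
  that column is nonzero because \<open>h\<close> is invertible.\<close>

lemma rank_rank_one_point: "rank (act h (sym_unit X33)) = 1"
proof -
  have entry: "act h (sym_unit X33) $ i $ j = h $ i $ 3 * h $ j $ 3" for i j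
    by (simp add: act_def matrix_matrix_mult_def sum_3 sym_unit_def sym_of_def transpose_def)
  have col: "(g ** h) $ 3 $ 3 = 1"
    by (simp add: gh mat_def)
  have "\<exists>i. h $ i $ 3 \<noteq> 0"
    using col by (rule contrapos_pp) (simp add: matrix_matrix_mult_def)
  then obtain i where i: "h $ i $ 3 \<noteq> 0" ..
  have row_eq: "row j (act h (sym_unit X33)) = (h $ j $ 3 / h $ i $ 3) *s row i (act h (sym_unit X33))" for j
    using i by (simp add: vec_eq_iff row_def entry)
  have "{row i (act h (sym_unit X33))} \<subseteq> rows (act h (sym_unit X33))"
    by (auto simp: rows_def)
  moreover have "rows (act h (sym_unit X33)) \<subseteq> vec.span {row i (act h (sym_unit X33))}"
  proof
    fix x assume "x \<in> rows (act h (sym_unit X33))"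
    then obtain j where "x = row j (act h (sym_unit X33))"
      by (auto simp: rows_def)
    then show "x \<in> vec.span {row i (act h (sym_unit X33))}"
      by (subst (asm) row_eq) (simp add: vec.span_base vec.span_scale)
  qed
  moreover have "vec.independent {row i (act h (sym_unit X33))}"
  proof -
    have "row i (act h (sym_unit X33)) \<noteq> 0"
      using i by (auto simp: vec_eq_iff row_def entry)
    then show ?thesis by simp
  qed
  ultimately show ?thesis
    unfolding row_rank_def_gen by (rule vec.dim_unique) simp
qed

text \<open>The known ideal elements kill every coordinate of \<open>act g A\<close> except
  \<open>X33\<close>. Conversely, the remaining point is the value of \<open>cone_curve\<close> at
  0.\<close>

lemma proj_zeros_base_locus_ideal:
  "proj_zeros (base_locus_ideal L) = {proj_point (act h (sym_unit X33))}"
proof (intro subset_antisym subsetI)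
  fix P assume P: "P \<in> proj_zeros (base_locus_ideal L)"
  then obtain A where A: "A \<in> sym3" "A \<noteq> 0" "P = proj_point A"
    by (auto simp: proj_zeros_def proj_def)
  have zero: "poly_eval f A = 0" if "f \<in> base_locus_ideal L" for f
    using P that A(3) by (auto simp: proj_zeros_def)
  define c where "c = coord (act g A) X33"
  have "coord (act g A) v = 0" if "v \<in> {X11, X12, X22, X23}" for v
    using zero[OF Y_in_base_locus_ideal[OF that]] A(1) by simp
  moreover have "coord (act g A) X13 = 0"
    using zero[OF Y13_square_in_base_locus_ideal] A(1) by (simp del: coord.simps)
  ultimately have "coord (act g A) v = coord (mscale c (sym_unit X33)) v" for v
    by (cases v) (simp_all add: c_def del: coord.simps)
  then have "act g A = mscale c (sym_unit X33)"
    using A(1) by (intro sym3_eqI) simp_all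
  then have A_eq: "A = mscale c (act h (sym_unit X33))"
    by (metis act_hg act_mscale)
  then have "c \<noteq> 0"
    using A(2) by (auto simp: mscale_def vec_eq_iff)
  have "proj_point A = proj_point (act h (sym_unit X33))"
  proof -
    have "mscale k (act h (sym_unit X33)) = mscale (k / c) A" for k
      using \<open>c \<noteq> 0\<close> by (simp add: A_eq mscale_def vec_eq_iff)
    moreover have "mscale k A = mscale (k * c) (act h (sym_unit X33))" for k
      by (simp add: A_eq mscale_def vec_eq_iff)
    ultimately show ?thesis
      using \<open>c \<noteq> 0\<close> unfolding proj_point_def
      by (metis (no_types, opaque_lifting) divide_eq_0_iff mult_eq_0_iff)
  qed
  with A(3) show "P \<in> {proj_point (act h (sym_unit X33))}" by simp
next
  fix P assume "P \<in> {proj_point (act h (sym_unit X33))}"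
  then have P: "P = proj_point (act h (sym_unit X33))" by simp
  have "act h (sym_unit X33) \<noteq> 0"
    by (rule act_g_nonzeroI[of _ X33]) (simp del: coord.simps)
  then have "P \<in> proj sym3"
    by (simp add: P proj_def)
  moreover have "poly_eval f (mscale c (act h (sym_unit X33))) = 0"
    if f: "f \<in> base_locus_ideal L" and "c \<noteq> 0" for f c
  proof -
    \<comment> \<open>Divisibility by \<open>s^2\<close> makes the constant term of the restriction
      vanish.\<close>
    have "poly_eval f (mscale c (cone_curve 0)) = poly (curve_poly (cone_curve_coord c) f) 0"
      by (simp add: poly_curve_poly[OF poly_cone_curve_coord])
    also have "\<dots> = 0"
      using dvd_curve_poly_base_locus_ideal[OF that] by (auto elim!: dvdE)
    also have "cone_curve 0 = act h (sym_unit X33)"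
      by (simp add: cone_curve_def)
    finally show ?thesis .
  qed
  ultimately show "P \<in> proj_zeros (base_locus_ideal L)"
    by (auto simp: P proj_zeros_def proj_point_def)
qed

text \<open>A monomial outside the ideal has no factor \<open>Y X11\<close>, \<open>Y X12\<close>,
  \<open>Y X22\<close>, \<open>Y X23\<close> and at most one factor \<open>Y X13\<close>; the power
  of \<open>Y X33\<close> makes up the degree.\<close>

lemma monomial_at_Y_cases:
  assumes "(\<Sum>v\<in>UNIV. Poly_Mapping.lookup m v) = d"
  shows "monomial_at Y m \<in> insert (Y X33 ^ d) (insert (Y X13 * Y X33 ^ (d - 1)) (base_locus_ideal L))"
proof -
  have dvd: "Y v ^ Poly_Mapping.lookup m v dvd monomial_at Y m" for v
    unfolding monomial_at_def by (rule dvd_prodI) simp_all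
  consider v where "v \<in> {X11, X12, X22, X23}" "Poly_Mapping.lookup m v > 0"
    | "Poly_Mapping.lookup m X13 \<ge> 2"
    | "\<And>v. v \<in> {X11, X12, X22, X23} \<Longrightarrow> Poly_Mapping.lookup m v = 0"
      "Poly_Mapping.lookup m X13 = 0 \<or> Poly_Mapping.lookup m X13 = 1"
    by fastforce
  then show ?thesis
  proof cases
    case (1 v)
    then have "Y v dvd monomial_at Y m"
      using dvd[of v] by (meson dvd_power dvd_trans)
    with 1(1) show ?thesis
      using Y_in_base_locus_ideal base_locus_ideal_dvd by blast
  next
    case 2
    then have "(Y X13)\<^sup>2 dvd monomial_at Y m"
      using dvd[of X13] by (meson le_imp_power_dvd dvd_trans)
    then show ?thesis
      using Y13_square_in_base_locus_ideal base_locus_ideal_dvd by blast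
  next
    case 3
    then show ?thesis
      using assms by (auto simp: monomial_at_def prod_sym_var sum_sym_var)
  qed
qed

text \<open>Positive degree ensures that \<open>Y X13 * Y X33 ^ (d - 1)\<close> really has degree
  \<open>d\<close>, as the subtraction truncates.\<close>

lemma hilbert_function_base_locus_ideal:
  assumes "d \<ge> 1"
  shows "hilbert_function (base_locus_ideal L) d = 2"
proof (rule hilbert_function_eq_2I)
  define u v where "u = Y X33 ^ d" and "v = Y X13 * Y X33 ^ (d - 1)"
  show "sympoly.subspace (base_locus_ideal L)"
    by (rule subspace_base_locus_ideal)
  show "u \<in> homogeneous_part d"
    using homogeneous_part_power[OF homogeneous_linear_form, of g X33 d] by (simp add: u_def)
  show "v \<in> homogeneous_part d"
    using homogeneous_part_mult[OF homogeneous_linear_form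
        homogeneous_part_power[OF homogeneous_linear_form], of g X13 g X33 "d - 1"] assms
    by (simp add: v_def)
  show "homogeneous_part d \<subseteq> sympoly.span (insert u (insert v (base_locus_ideal L)))"
  proof
    fix f assume "f \<in> homogeneous_part d"
    \<comment> \<open>The coefficients of this pullback express \<open>f\<close> as a combination of
      monomials in the forms \<open>Y\<close>.\<close>
    then have f': "linear_change h f \<in> homogeneous_part d"
      by (rule homogeneous_linear_change)
    have "f = linear_change g (linear_change h f)"
      by (simp add: linear_change_inverse hg)
    also have "\<dots> \<in> sympoly.span (insert u (insert v (base_locus_ideal L)))"
      unfolding linear_change_def[of g] u_def v_def
      using f' by (intro sympoly.span_sum sympoly.span_scale sympoly.span_base monomial_at_Y_cases)
        (simp add: homogeneous_part_iff)
    finally show "f \<in> sympoly.span (insert u (insert v (base_locus_ideal L)))" .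
  qed
  show "\<alpha> = 0 \<and> \<beta> = 0" if "poly_scale \<alpha> u + poly_scale \<beta> v \<in> base_locus_ideal L" for \<alpha> \<beta>
  proof -
    \<comment> \<open>On the curve \<open>Y X33\<close> is 1 and \<open>Y X13\<close> is
      \<open>s\<close>, so \<open>u\<close> restricts to 1 and \<open>v\<close> to
      \<open>s\<close>.\<close>
    have "poly (curve_poly (cone_curve_coord 1) (poly_scale \<alpha> u + poly_scale \<beta> v)) s = poly [:\<alpha>, \<beta>:] s" for s
      by (simp add: poly_curve_poly[OF poly_cone_curve_coord] u_def v_def cone_curve_def act_mscale
          del: coord.simps)
    then have "curve_poly (cone_curve_coord 1) (poly_scale \<alpha> u + poly_scale \<beta> v) = [:\<alpha>, \<beta>:]"
      by (intro poly_ext)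
    \<comment> \<open>A polynomial of degree at most 1 that is divisible by \<open>s^2\<close> is
      zero.\<close>
    then have "[:0, 0, 1:] dvd [:\<alpha>, \<beta>:]"
      using dvd_curve_poly_base_locus_ideal[OF that, of 1] by simp
    then show ?thesis
      by (auto elim!: dvdE)
  qed
qed

text \<open>The Hilbert polynomial is the constant 2, of degree 0, so the factorial factor in
  \<open>scheme_degree\<close> is 1.\<close>

lemma double_point: "double_point_at (base_locus_ideal L) (proj_point (act h (sym_unit X33)))"
proof -
  have "hilbert_polynomial (base_locus_ideal L) = [:2:]"
  proof (rule hilbert_polynomial_eqI)
    show "\<forall>\<^sub>F d in sequentially. poly [:2:] (real d) = real (hilbert_function (base_locus_ideal L) d)"
      using eventually_ge_at_top[of 1] by eventually_elim (simp add: hilbert_function_base_locus_ideal)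
  qed
  then show ?thesis
    by (simp add: double_point_at_def proj_zeros_base_locus_ideal scheme_degree_def)
qed

section \<open>The ML-degree\<close>

text \<open>At a critical point \<open>M\<close> the matrices \<open>g M\<^sup>-\<^sup>1 g\<^sup>T\<close> and \<open>g S g\<^sup>T\<close> share their (1,2) entry,
  which vanishes for the former.\<close>

lemma critical_points_empty:
  assumes "S \<in> sym3" "poly_eval (Y X12) S \<noteq> 0"
  shows "critical_points L S = {}"
proof (rule ccontr)
  assume "critical_points L S \<noteq> {}"
  then obtain M where M: "M \<in> L" "invertible M"
    and crit: "\<And>N. N \<in> L \<Longrightarrow> trace (matrix_inv M ** N) = trace (S ** N)"
    by (auto simp: critical_points_def)
  have inv: "matrix_inv M \<in> inverse_net L"
    using M by (auto simp: inverse_net_def invertible_det_nz)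
  \<comment> \<open>The direction \<open>std_conic 0 1 0\<close> is the conic \<open>2xy\<close>,
    whose pairing picks out twice the (1,2) entry.\<close>
  have tr: "trace (B ** act (transpose g) (std_conic 0 1 0)) = 2 * coord (act g B) X12"
    if "B \<in> sym3" for B
    by (subst trace_mul_sym) (simp add: that trace_act trace_std_conic del: coord.simps)
  have "act (transpose g) (std_conic 0 1 0) \<in> L"
    unfolding L_eq by blast
  from crit[OF this] have "2 * coord (act g (matrix_inv M)) X12 = 2 * coord (act g S) X12"
    using inv inverse_net_subset_sym3 assms(1) by (simp only: tr subset_iff)
  then show False
    using coord_act_inverse_net(1)[OF inv] assms by (simp del: coord.simps)
qed

text \<open>The form takes the value 1 at \<open>act h (sym_unit v)\<close>.\<close>

lemma Y_nonzero: "Y v \<noteq> 0"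
proof
  assume "Y v = 0"
  then have "coord (act g (act h (sym_unit v))) v = 0"
    by (metis act_in_sym3 poly_eval_0 poly_eval_linear_form sym_unit_in_sym3)
  then show False by simp
qed

text \<open>For uniqueness, any other generic value is compared with 0 at a matrix that satisfies
  both generic conditions.\<close>

lemma ml_degree_eq_0: "ml_degree L = 0"
  unfolding ml_degree_def
proof (rule the_equality)
  show "generic_sym (\<lambda>S. finite (critical_points L S) \<and> card (critical_points L S) = 0)"
    unfolding generic_sym_def
    by (intro exI[of _ "Y X12"] conjI ballI impI) (simp_all add: Y_nonzero critical_points_empty)
next
  fix n assume "generic_sym (\<lambda>S. finite (critical_points L S) \<and> card (critical_points L S) = n)"
  then obtain f where f: "f \<noteq> 0"
    "\<And>S. S \<in> sym3 \<Longrightarrow> poly_eval f S \<noteq> 0 \<Longrightarrow> card (critical_points L S) = n"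
    unfolding generic_sym_def by blast
  obtain S where "S \<in> sym3" "poly_eval f S \<noteq> 0" "poly_eval (Y X12) S \<noteq> 0"
    using ex_common_nonzero[OF f(1) Y_nonzero] .
  with f(2) critical_points_empty show "n = 0"
    by fastforce
qed

end

theorem proposition4p11:
  fixes L :: "(complex^3^3) set"
  assumes "net_of_conics L"
    and "type_Gstar L"
  shows "(\<exists>A\<in>sym3. rank A = 1 \<and> double_point_at (base_locus_ideal L) (proj_point A))
    \<and> ml_degree L = 0"
proof -
  obtain g where g: "invertible g"
    and L: "L = (\<lambda>A. transpose g ** A ** g) ` cmat_span {conic_x2, conic_2xy, conic_2yz}"
    using assms(2) by (auto simp: type_Gstar_def congruent_nets_def)
  from g obtain h where "g ** h = mat 1" "h ** g = mat 1"
    by (auto simp: invertible_def)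
  moreover have "L = {act (transpose g) (std_conic a b c) | a b c. True}"
    unfolding L std_net_eq act_def transpose_transpose by blast
  ultimately interpret Gstar_net g h L
    by unfold_locales
  show ?thesis
    using rank_one_point_in_sym3 rank_rank_one_point double_point ml_degree_eq_0 by blast
qed

end
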